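(* Let $t\geq 2$ be an integer and let $q$ be a prime power with $q\geq 2t-1$. Then there exists a $q^t$-CMS$(q^t,t)$, i.e. a set of $q^t$ complementary $t$-multimagic squares of order $q^t$.
   Context: Let $I_n=\{0,1,\dots,n-1\}$. An $n\times n$ integer matrix is a general magic square if all row sums, column sums, the main diagonal sum and the back diagonal sum (entries $(i,n-1-i)$) are equal. A general magic square $M=(m_{i,j})$ is a general $t$-multimagic square if each entrywise power $M^{*e}=(m_{i,j}^e)$, $e=1,\dots,t$, is a general magic square; if moreover its entries are exactly $0,1,\dots,n^2-1$ (consecutive integers) it is an MS$(n,t)$. Define $S_e(n)=\frac{1}{n}\sum_{k\in I_{n^2}}k^e$. Let $B_s=(b^{(s)}_{i,j})$, $s\in I_m$, be $m$ MS$(n,t)$s with entries $0,\dots,n^2-1$. Then $\{B_0,\dots,B_{m-1}\}$ is a set of complementary $t$-multimagic squares, denoted $m$-CMS$(n,t)$, if (R1) $\sum_{s\in I_m}\sum_{j\in I_n}(b^{(s)}_{i,j})^{t+1}=mS_{t+1}(n)$ for every $i\in I_n$; (R2) $\sum_{s\in I_m}\sum_{i\in I_n}(b^{(s)}_{i,j})^{t+1}=mS_{t+1}(n)$ for every $j\in I_n$; (R3) $\sum_{s\in I_m}\sum_{i\in I_n}(b^{(s)}_{i,i})^{t+1}=\sum_{s\in I_m}\sum_{i\in I_n}(b^{(s)}_{i,n-1-i})^{t+1}=mS_{t+1}(n)$. *)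

theory Defs
  imports Complex_Main "HOL-Computational_Algebra.Primes"
begin

text \<open>An n x n integer matrix is represented as a function M :: nat => nat => int,
  of which only the entries M i j with i < n, j < n are relevant.\<close>

definition general_magic :: "nat \<Rightarrow> (nat \<Rightarrow> nat \<Rightarrow> int) \<Rightarrow> bool" where
  "general_magic n M \<longleftrightarrow>
     (\<exists>c. (\<forall>i<n. (\<Sum>j<n. M i j) = c) \<and>
          (\<forall>j<n. (\<Sum>i<n. M i j) = c) \<and>
          (\<Sum>i<n. M i i) = c \<and>
          (\<Sum>i<n. M i (n - 1 - i)) = c)"

definition entry_power :: "(nat \<Rightarrow> nat \<Rightarrow> int) \<Rightarrow> nat \<Rightarrow> (nat \<Rightarrow> nat \<Rightarrow> int)" where
  "entry_power M e = (\<lambda>i j. (M i j) ^ e)"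

definition general_multimagic :: "nat \<Rightarrow> nat \<Rightarrow> (nat \<Rightarrow> nat \<Rightarrow> int) \<Rightarrow> bool" where
  "general_multimagic n t M \<longleftrightarrow> (\<forall>e\<in>{1..t}. general_magic n (entry_power M e))"

definition MS :: "nat \<Rightarrow> nat \<Rightarrow> (nat \<Rightarrow> nat \<Rightarrow> int) \<Rightarrow> bool" where
  "MS n t M \<longleftrightarrow> general_multimagic n t M \<and>
     bij_betw (\<lambda>(i, j). M i j) ({..<n} \<times> {..<n}) {0..<int (n ^ 2)}"

definition S_pow :: "nat \<Rightarrow> nat \<Rightarrow> real" where
  "S_pow e n = (1 / real n) * (\<Sum>k<n ^ 2. real k ^ e)"

definition CMS :: "nat \<Rightarrow> nat \<Rightarrow> nat \<Rightarrow> (nat \<Rightarrow> nat \<Rightarrow> nat \<Rightarrow> int) \<Rightarrow> bool" where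
  "CMS m n t B \<longleftrightarrow>
     (\<forall>s<m. MS n t (B s)) \<and>
     (\<forall>i<n. (\<Sum>s<m. \<Sum>j<n. real_of_int (B s i j) ^ (t + 1)) = real m * S_pow (t + 1) n) \<and>
     (\<forall>j<n. (\<Sum>s<m. \<Sum>i<n. real_of_int (B s i j) ^ (t + 1)) = real m * S_pow (t + 1) n) \<and>
     (\<Sum>s<m. \<Sum>i<n. real_of_int (B s i i) ^ (t + 1)) = real m * S_pow (t + 1) n \<and>
     (\<Sum>s<m. \<Sum>i<n. real_of_int (B s i (n - 1 - i)) ^ (t + 1)) = real m * S_pow (t + 1) n"

definition prime_power :: "nat \<Rightarrow> bool" where
  "prime_power q \<longleftrightarrow> (\<exists>p k. prime p \<and> k \<ge> 1 \<and> q = p ^ k)"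

end

theory Submission
  imports "HOL-Algebra.Algebraic_Closure" "HOL-Number_Theory.Residues" Defs
begin

text \<open>
  Write the entries of a square of order \<open>q ^ t\<close> with \<open>2 * t\<close> digits in base \<open>q\<close>.  If along a line any
  \<open>t\<close> digit positions take every combination of values exactly once, then the sum of the \<open>e\<close>-th powers
  is the same for every such line and \<open>e \<le> t\<close>, because each monomial of the expanded power involves at
  most \<open>t\<close> digits.  Shifting the upper \<open>t\<close> digits cyclically by the digits of \<open>s < q ^ t\<close> preserves
  this, and on each line the \<open>q ^ t\<close> shifted copies together contain every number below \<open>q ^ (2 * t)\<close> exactly
  once, which gives the complementarity for the power \<open>t + 1\<close> (and any other).

  For the digits, let \<open>M\<close> be the encoding map of the extended Reed--Solomon code of length
  \<open>2 * t \<le> q + 1\<close> and dimension \<open>t\<close> over the field with \<open>q\<close> elements, and take \<open>M i + c * M j\<close> in the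
  lower half and \<open>M i + d * M j\<close> in the upper half, where \<open>c \<noteq> d\<close> avoid \<open>0, 1, -1\<close>.  The rows are
  enumerated such that reversal of the index is \<open>i \<mapsto> e - i\<close>, so that rows, columns and both diagonals
  are translates of the code with its coordinates scaled by nonzero factors.  Such \<open>c\<close> and \<open>d\<close> exist
  unless \<open>q = 3\<close>, in which case \<open>t = 2\<close> and four explicit linear forms do the job.
\<close>

section \<open>Base-\<open>q\<close> digit expansions\<close>

definition digits_val :: "nat \<Rightarrow> nat \<Rightarrow> (nat \<Rightarrow> nat) \<Rightarrow> nat" where
  "digits_val q N d = (\<Sum>k<N. d k * q ^ k)"

lemma digits_val_Suc: "digits_val q (Suc N) d = d 0 + q * digits_val q N (\<lambda>k. d (Suc k))"
  unfolding digits_val_def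
  by (subst sum.lessThan_Suc_shift) (simp add: sum_distrib_left mult_ac)

lemma digits_val_less:
  assumes "\<And>k. k < N \<Longrightarrow> d k < q"
  shows "digits_val q N d < q ^ N"
  using assms
proof (induction N arbitrary: d)
  case 0
  then show ?case by (simp add: digits_val_def)
next
  case (Suc N)
  have "digits_val q N (\<lambda>k. d (Suc k)) + 1 \<le> q ^ N"
    using Suc.IH[of "\<lambda>k. d (Suc k)"] Suc.prems by force
  then have "q * (digits_val q N (\<lambda>k. d (Suc k)) + 1) \<le> q * q ^ N"
    by (rule mult_le_mono2)
  moreover have "d 0 < q" using Suc.prems by simp
  ultimately show ?case by (simp add: digits_val_Suc)
qed

lemma digits_val_inject:
  assumes "\<And>k. k < N \<Longrightarrow> d k < q" and "\<And>k. k < N \<Longrightarrow> d' k < q"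
    and "digits_val q N d = digits_val q N d'" and "k < N"
  shows "d k = d' k"
  using assms
proof (induction N arbitrary: d d' k)
  case (Suc N)
  have lt: "d 0 < q" "d' 0 < q" using Suc.prems by simp_all
  have eq: "d 0 + q * digits_val q N (\<lambda>k. d (Suc k)) = d' 0 + q * digits_val q N (\<lambda>k. d' (Suc k))"
    using Suc.prems(3) by (simp add: digits_val_Suc)
  have "d 0 = d' 0"
    using arg_cong[OF eq, of "\<lambda>x. x mod q"] lt by simp
  moreover from this eq lt have "digits_val q N (\<lambda>k. d (Suc k)) = digits_val q N (\<lambda>k. d' (Suc k))"
    by auto
  ultimately show ?case
    using Suc.IH[of "\<lambda>k. d (Suc k)" "\<lambda>k. d' (Suc k)" "k - 1"] Suc.prems by (cases k) auto
qed simp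

text \<open>Induction on the number of digits: \<open>s mod q\<close> is the lowest digit, and the
  digits of \<open>s div q\<close> are those of \<open>s\<close> moved down by one.\<close>

lemma eq_if_digits_eq:
  fixes q :: nat
  assumes "s < q ^ t" and "s' < q ^ t" and "\<And>k. k < t \<Longrightarrow> s div q ^ k mod q = s' div q ^ k mod q"
  shows "s = s'"
  using assms
proof (induction t arbitrary: s s')
  case (Suc t)
  have "s div q = s' div q"
  proof (rule Suc.IH)
    show "s div q < q ^ t" "s' div q < q ^ t"
      using Suc.prems(1,2) by (simp_all add: less_mult_imp_div_less mult.commute)
    show "s div q div q ^ k mod q = s' div q div q ^ k mod q" if "k < t" for k
      using Suc.prems(3)[of "Suc k"] that by (simp add: div_mult2_eq)
  qed
  moreover have "s mod q = s' mod q"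
    using Suc.prems(3)[of 0] by simp
  ultimately show ?case
    by (metis div_mult_mod_eq)
qed simp

section \<open>Orthogonal arrays and power sums\<close>

text \<open>An orthogonal array of index one and strength \<open>t\<close>, with \<open>N\<close> factors on \<open>q\<close> levels;
  its runs are indexed by \<open>x < q ^ t\<close>.\<close>

definition orth_array :: "nat \<Rightarrow> nat \<Rightarrow> nat \<Rightarrow> (nat \<Rightarrow> nat \<Rightarrow> nat) \<Rightarrow> bool" where
  "orth_array q t N D \<longleftrightarrow>
     (\<forall>x<q ^ t. \<forall>k<N. D x k < q) \<and>
     (\<forall>T. T \<subseteq> {..<N} \<and> card T = t \<longrightarrow> inj_on (\<lambda>x. restrict (D x) T) {..<q ^ t})"

text \<open>Injectivity is enough for every combination of values to occur exactly once, since there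
  are as many runs as functions from \<open>T\<close> to the \<open>q\<close> levels, namely
  \<open>q ^ t\<close>.\<close>

lemma orth_array_bij_betw:
  assumes "orth_array q t N D" and "T \<subseteq> {..<N}" and "card T = t"
  shows "bij_betw (\<lambda>x. restrict (D x) T) {..<q ^ t} (T \<rightarrow>\<^sub>E {..<q})"
proof -
  have fin: "finite T" using assms(2) finite_subset by blast
  have inj: "inj_on (\<lambda>x. restrict (D x) T) {..<q ^ t}"
    using assms by (simp add: orth_array_def)
  have "(\<lambda>x. restrict (D x) T) ` {..<q ^ t} = (T \<rightarrow>\<^sub>E {..<q})"
  proof (rule card_subset_eq)
    show "finite (T \<rightarrow>\<^sub>E {..<q})" using fin by (simp add: finite_PiE)
    show "(\<lambda>x. restrict (D x) T) ` {..<q ^ t} \<subseteq> (T \<rightarrow>\<^sub>E {..<q})"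
      using assms unfolding orth_array_def by (auto simp: PiE_iff)
    show "card ((\<lambda>x. restrict (D x) T) ` {..<q ^ t}) = card (T \<rightarrow>\<^sub>E {..<q})"
      using card_image[OF inj] fin assms(3) by (simp add: card_PiE)
  qed
  with inj show ?thesis by (simp add: bij_betw_def)
qed

text \<open>Here \<open>g\<close> selects, for each of the \<open>e\<close> factors, the digit
  position that contributes; the monomial of \<open>g\<close> thus involves at most \<open>e\<close>
  distinct digits.\<close>

lemma digits_val_power_expand:
  "digits_val q N d ^ e = (\<Sum>g\<in>{..<e} \<rightarrow>\<^sub>E {..<N}. \<Prod>l<e. d (g l) * q ^ g l)"
proof -
  have "digits_val q N d ^ e = (\<Prod>l<e. \<Sum>k<N. d k * q ^ k)"
    by (simp add: digits_val_def)
  also have "\<dots> = (\<Sum>g\<in>{..<e} \<rightarrow>\<^sub>E {..<N}. \<Prod>l<e. d (g l) * q ^ g l)"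
    by (rule prod_sum_PiE) auto
  finally show ?thesis .
qed

text \<open>The positions used by a monomial extend to a set \<open>T\<close> of exactly
  \<open>t\<close> positions. Reindexing the runs by their restrictions to \<open>T\<close> turns
  its sum into one over all functions from \<open>T\<close> to the levels, in which the array no
  longer occurs.\<close>

lemma orth_array_power_sum_unique:
  assumes "orth_array q t N D" and "orth_array q t N D'" and "e \<le> t" and "t \<le> N"
  shows "(\<Sum>x<q ^ t. digits_val q N (D x) ^ e) = (\<Sum>x<q ^ t. digits_val q N (D' x) ^ e)"
proof -
  have main: "(\<Sum>x<q ^ t. \<Prod>l<e. D x (g l) * q ^ g l) = (\<Sum>x<q ^ t. \<Prod>l<e. D' x (g l) * q ^ g l)"
    if g: "g \<in> {..<e} \<rightarrow>\<^sub>E {..<N}" for g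
  proof -
    have sub: "g ` {..<e} \<subseteq> {..<N}" using g by auto
    have "card (g ` {..<e}) \<le> t" using card_image_le[of "{..<e}" g] assms(3) by simp
    then obtain T where T: "g ` {..<e} \<subseteq> T" "T \<subseteq> {..<N}" "card T = t"
      using exists_subset_between[of "g ` {..<e}" t "{..<N}"] sub assms(4) by auto
    have "(\<Sum>x<q ^ t. \<Prod>l<e. A x (g l) * q ^ g l) = (\<Sum>h\<in>T \<rightarrow>\<^sub>E {..<q}. \<Prod>l<e. h (g l) * q ^ g l)"
      if "orth_array q t N A" for A
    proof -
      have "(\<Sum>x<q ^ t. \<Prod>l<e. A x (g l) * q ^ g l)
          = (\<Sum>x<q ^ t. \<Prod>l<e. restrict (A x) T (g l) * q ^ g l)"
        using T(1) by (intro sum.cong prod.cong) auto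
      also have "\<dots> = (\<Sum>h\<in>T \<rightarrow>\<^sub>E {..<q}. \<Prod>l<e. h (g l) * q ^ g l)"
        by (rule sum.reindex_bij_betw[OF orth_array_bij_betw[OF that T(2,3)]])
      finally show ?thesis .
    qed
    from this[OF assms(1)] this[OF assms(2)] show ?thesis by simp
  qed
  have "(\<Sum>x<q ^ t. digits_val q N (D x) ^ e)
      = (\<Sum>g\<in>{..<e} \<rightarrow>\<^sub>E {..<N}. \<Sum>x<q ^ t. \<Prod>l<e. D x (g l) * q ^ g l)"
    unfolding digits_val_power_expand by (rule sum.swap)
  also have "\<dots> = (\<Sum>g\<in>{..<e} \<rightarrow>\<^sub>E {..<N}. \<Sum>x<q ^ t. \<Prod>l<e. D' x (g l) * q ^ g l)"
    using main by (rule sum.cong[OF refl])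
  also have "\<dots> = (\<Sum>x<q ^ t. digits_val q N (D' x) ^ e)"
    unfolding digits_val_power_expand by (rule sum.swap)
  finally show ?thesis .
qed

section \<open>Cyclic shifts of the upper digits\<close>

text \<open>The quotient \<open>s div q ^ (k - t)\<close> need not be reduced to a single digit of
  \<open>s\<close>, because the final \<open>mod q\<close> discards the higher digits.\<close>

definition shift_digits :: "nat \<Rightarrow> nat \<Rightarrow> nat \<Rightarrow> (nat \<Rightarrow> nat) \<Rightarrow> nat \<Rightarrow> nat" where
  "shift_digits q t s d k = (if k < t then d k else (d k + s div q ^ (k - t)) mod q)"

lemma shift_digits_less: "d k < q \<Longrightarrow> shift_digits q t s d k < q"
  by (simp add: shift_digits_def)

lemma add_mod_right_cancel_less:
  fixes a b m q :: nat
  assumes "a < q" and "b < q" and "(a + m) mod q = (b + m) mod q"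
  shows "a = b"
  using assms cong_add_rcancel_nat[of a m b q] cong_less_modulus_unique_nat[of a b q]
  by (simp add: cong_def)

lemma shift_digits_inject:
  assumes "d k < q" and "d' k < q" and "shift_digits q t s d k = shift_digits q t s d' k"
  shows "d k = d' k"
  using assms add_mod_right_cancel_less by (auto simp: shift_digits_def split: if_splits)

text \<open>The shift permutes the levels separately in each position, so equal restrictions after
  shifting were equal before.\<close>

lemma orth_array_shift_digits:
  assumes "orth_array q t N D"
  shows "orth_array q t N (\<lambda>x. shift_digits q t s (D x))"
  unfolding orth_array_def
proof (intro conjI allI impI)
  fix x k assume "x < q ^ t" "k < N"
  then show "shift_digits q t s (D x) k < q"
    using assms by (simp add: shift_digits_less orth_array_def)
next
  fix T assume T: "T \<subseteq> {..<N} \<and> card T = t"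
  show "inj_on (\<lambda>x. restrict (shift_digits q t s (D x)) T) {..<q ^ t}"
  proof (rule inj_onI)
    fix x y assume xy: "x \<in> {..<q ^ t}" "y \<in> {..<q ^ t}"
      and eq: "restrict (shift_digits q t s (D x)) T = restrict (shift_digits q t s (D y)) T"
    have "D x k = D y k" if "k \<in> T" for k
    proof (rule shift_digits_inject[of "D x" k q "D y" t s])
      show "D x k < q" "D y k < q" using assms xy T that by (auto simp: orth_array_def)
      show "shift_digits q t s (D x) k = shift_digits q t s (D y) k"
        using fun_cong[OF eq, of k] that by simp
    qed
    then have "restrict (D x) T = restrict (D y) T" by (auto simp: restrict_def)
    then show "x = y" using assms T xy by (auto simp: orth_array_def dest: inj_onD)
  qed
qed

text \<open>The lower \<open>t\<close> digits are not shifted and determine the run \<open>x\<close>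
  by strength \<open>t\<close>; given \<open>x\<close>, the upper \<open>t\<close> digits reveal the
  digits of \<open>s\<close>. Counting both sides turns injectivity into bijectivity.\<close>

lemma orth_array_shift_bij_betw:
  assumes "orth_array q t (2 * t) D"
  shows "bij_betw (\<lambda>(s, x). digits_val q (2 * t) (shift_digits q t s (D x)))
           ({..<q ^ t} \<times> {..<q ^ t}) {..<(q ^ t)\<^sup>2}"
proof -
  let ?f = "\<lambda>(s, x). digits_val q (2 * t) (shift_digits q t s (D x))"
  have less: "shift_digits q t s (D x) k < q" if "x < q ^ t" "k < 2 * t" for s x k
    using assms that by (simp add: shift_digits_less orth_array_def)
  have inj: "inj_on ?f ({..<q ^ t} \<times> {..<q ^ t})"
  proof (rule inj_onI, clarsimp)
    fix s x s' x' assume *: "s < q ^ t" "x < q ^ t" "s' < q ^ t" "x' < q ^ t"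
      and eq: "digits_val q (2 * t) (shift_digits q t s (D x)) =
               digits_val q (2 * t) (shift_digits q t s' (D x'))"
    have dig: "shift_digits q t s (D x) k = shift_digits q t s' (D x') k" if "k < 2 * t" for k
      using digits_val_inject[OF _ _ eq that] less * by simp
    have "D x k = D x' k" if "k < t" for k
      using dig[of k] that by (simp add: shift_digits_def)
    then have "restrict (D x) {..<t} = restrict (D x') {..<t}" by (auto simp: restrict_def)
    moreover have "inj_on (\<lambda>x. restrict (D x) {..<t}) {..<q ^ t}"
      using assms by (auto simp: orth_array_def)
    ultimately have x: "x = x'" using * by (auto dest: inj_onD)
    have "s = s'"
    proof (rule eq_if_digits_eq[where q = q and t = t])
      show "s < q ^ t" "s' < q ^ t" using * by auto
      show "s div q ^ k mod q = s' div q ^ k mod q" if "k < t" for k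
      proof -
        have q: "q > 0" using less[of x k s] that * by force
        have "(s div q ^ k mod q + D x (k + t)) mod q = (s' div q ^ k mod q + D x (k + t)) mod q"
          using dig[of "k + t"] that x by (simp add: shift_digits_def mod_simps add.commute)
        then show ?thesis using q add_mod_right_cancel_less by (metis mod_less_divisor)
      qed
    qed
    with x show "s = s' \<and> x = x'" by simp
  qed
  have "?f ` ({..<q ^ t} \<times> {..<q ^ t}) = {..<(q ^ t)\<^sup>2}"
  proof (rule card_subset_eq)
    show "?f ` ({..<q ^ t} \<times> {..<q ^ t}) \<subseteq> {..<(q ^ t)\<^sup>2}"
      using digits_val_less[of "2 * t" _ q] less by (fastforce simp: power_mult[symmetric] mult.commute)
    show "card (?f ` ({..<q ^ t} \<times> {..<q ^ t})) = card {..<(q ^ t)\<^sup>2}"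
      using card_image[OF inj] by (simp add: power2_eq_square)
  qed simp
  with inj show ?thesis by (simp add: bij_betw_def)
qed

lemma orth_array_shift_power_sum:
  assumes "orth_array q t (2 * t) D" and "q > 0"
  shows "(\<Sum>s<q ^ t. \<Sum>x<q ^ t. real_of_int (int (digits_val q (2 * t) (shift_digits q t s (D x)))) ^ (t + 1))
       = real (q ^ t) * S_pow (t + 1) (q ^ t)"
proof -
  have "(\<Sum>s<q ^ t. \<Sum>x<q ^ t. real_of_int (int (digits_val q (2 * t) (shift_digits q t s (D x)))) ^ (t + 1))
     = (\<Sum>sx\<in>{..<q ^ t} \<times> {..<q ^ t}.
          real ((\<lambda>(s, x). digits_val q (2 * t) (shift_digits q t s (D x))) sx) ^ (t + 1))"
    by (simp add: sum.cartesian_product split_beta)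
  also have "\<dots> = (\<Sum>k<(q ^ t)\<^sup>2. real k ^ (t + 1))"
    by (rule sum.reindex_bij_betw[OF orth_array_shift_bij_betw[OF assms(1)]])
  finally show ?thesis using assms(2) by (simp add: S_pow_def)
qed

section \<open>From digit arrays to complementary multimagic squares\<close>

text \<open>Collects all that the algebra has to supply. Injectivity of the digit vectors makes the
  entries of each shifted square consecutive; the arrays on rows, columns and diagonals give equal
  power sums up to \<open>t\<close> within a square, and the sums of the powers \<open>t + 1\<close>
  over all shifts.\<close>

lemma CMS_if_digit_array:
  assumes "q > 0"
    and less: "\<And>i j k. i < q ^ t \<Longrightarrow> j < q ^ t \<Longrightarrow> k < 2 * t \<Longrightarrow> E i j k < q"
    and inj: "inj_on (\<lambda>(i, j). restrict (E i j) {..<2 * t}) ({..<q ^ t} \<times> {..<q ^ t})"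
    and row: "\<And>i. i < q ^ t \<Longrightarrow> orth_array q t (2 * t) (\<lambda>j. E i j)"
    and col: "\<And>j. j < q ^ t \<Longrightarrow> orth_array q t (2 * t) (\<lambda>i. E i j)"
    and diag: "orth_array q t (2 * t) (\<lambda>i. E i i)"
    and anti: "orth_array q t (2 * t) (\<lambda>i. E i (q ^ t - 1 - i))"
  shows "\<exists>B. CMS (q ^ t) (q ^ t) t B"
proof -
  define V where "V s i j = digits_val q (2 * t) (shift_digits q t s (E i j))" for s i j
  have bij: "bij_betw (\<lambda>(i, j). int (V s i j)) ({..<q ^ t} \<times> {..<q ^ t}) {0..<int ((q ^ t)\<^sup>2)}" for s
  proof -
    have injV: "inj_on (\<lambda>(i, j). V s i j) ({..<q ^ t} \<times> {..<q ^ t})"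
    proof (rule inj_onI, clarsimp)
      fix i j i' j' assume *: "i < q ^ t" "j < q ^ t" "i' < q ^ t" "j' < q ^ t"
        and eq: "V s i j = V s i' j'"
      have "E i j k = E i' j' k" if "k < 2 * t" for k
      proof (rule shift_digits_inject[of "E i j" k q "E i' j'" t s])
        show "E i j k < q" "E i' j' k < q" using less * that by auto
        show "shift_digits q t s (E i j) k = shift_digits q t s (E i' j') k"
          using digits_val_inject[OF _ _ eq[unfolded V_def] that] less * shift_digits_less by simp
      qed
      then have "restrict (E i j) {..<2 * t} = restrict (E i' j') {..<2 * t}"
        by (auto simp: restrict_def)
      then show "i = i' \<and> j = j'" using inj_onD[OF inj, of "(i, j)" "(i', j')"] * by auto
    qed
    have "(\<lambda>(i, j). V s i j) ` ({..<q ^ t} \<times> {..<q ^ t}) = {..<(q ^ t)\<^sup>2}"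
    proof (rule card_subset_eq)
      have "V s i j < (q ^ t)\<^sup>2" if "i < q ^ t" "j < q ^ t" for i j
        using digits_val_less[of "2 * t" "shift_digits q t s (E i j)" q] less that shift_digits_less
        by (simp add: V_def power_mult[symmetric] mult.commute)
      then show "(\<lambda>(i, j). V s i j) ` ({..<q ^ t} \<times> {..<q ^ t}) \<subseteq> {..<(q ^ t)\<^sup>2}" by auto
      show "card ((\<lambda>(i, j). V s i j) ` ({..<q ^ t} \<times> {..<q ^ t})) = card {..<(q ^ t)\<^sup>2}"
        using card_image[OF injV] by (simp add: power2_eq_square)
    qed simp
    with injV have "bij_betw (\<lambda>(i, j). V s i j) ({..<q ^ t} \<times> {..<q ^ t}) {..<(q ^ t)\<^sup>2}"
      by (simp add: bij_betw_def)
    moreover have "bij_betw int {..<(q ^ t)\<^sup>2} {0..<int ((q ^ t)\<^sup>2)}"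
      by (simp add: bij_betw_def atLeast0LessThan[symmetric] image_int_atLeastLessThan)
    ultimately have "bij_betw (int \<circ> (\<lambda>(i, j). V s i j)) ({..<q ^ t} \<times> {..<q ^ t}) {0..<int ((q ^ t)\<^sup>2)}"
      by (rule bij_betw_trans)
    then show ?thesis by (simp add: comp_def case_prod_unfold)
  qed
  have magic: "general_magic (q ^ t) (entry_power (\<lambda>i j. int (V s i j)) e)" if "e \<in> {1..t}" for s e
  proof -
    \<comment> \<open>The main diagonal serves as the reference line; every other line is compared
      with it.\<close>
    define c where "c = int (\<Sum>x<q ^ t. digits_val q (2 * t) (shift_digits q t s (E x x)) ^ e)"
    have *: "(\<Sum>x<q ^ t. int (digits_val q (2 * t) (shift_digits q t s (D x))) ^ e) = c"
      if "orth_array q t (2 * t) D" for D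
    proof -
      have "(\<Sum>x<q ^ t. digits_val q (2 * t) (shift_digits q t s (D x)) ^ e)
          = (\<Sum>x<q ^ t. digits_val q (2 * t) (shift_digits q t s (E x x)) ^ e)"
        using \<open>e \<in> {1..t}\<close>
        by (intro orth_array_power_sum_unique orth_array_shift_digits that diag) auto
      then show ?thesis unfolding c_def by (simp flip: of_nat_power of_nat_sum)
    qed
    show ?thesis
      unfolding general_magic_def entry_power_def V_def
      using *[OF row] *[OF col] *[OF diag] *[OF anti] by (intro exI[of _ c]) auto
  qed
  have sums: "(\<forall>i<q ^ t. (\<Sum>s<q ^ t. \<Sum>j<q ^ t. real_of_int (int (V s i j)) ^ (t + 1)) = real (q ^ t) * S_pow (t + 1) (q ^ t))"
    "(\<forall>j<q ^ t. (\<Sum>s<q ^ t. \<Sum>i<q ^ t. real_of_int (int (V s i j)) ^ (t + 1)) = real (q ^ t) * S_pow (t + 1) (q ^ t))"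
    "(\<Sum>s<q ^ t. \<Sum>i<q ^ t. real_of_int (int (V s i i)) ^ (t + 1)) = real (q ^ t) * S_pow (t + 1) (q ^ t)"
    "(\<Sum>s<q ^ t. \<Sum>i<q ^ t. real_of_int (int (V s i (q ^ t - 1 - i))) ^ (t + 1)) = real (q ^ t) * S_pow (t + 1) (q ^ t)"
    unfolding V_def
    using row col diag anti by (intro allI impI orth_array_shift_power_sum[OF _ assms(1)]; simp)+
  have "CMS (q ^ t) (q ^ t) t (\<lambda>s i j. int (V s i j))"
    unfolding CMS_def MS_def general_multimagic_def
    by (intro conjI allI impI ballI magic bij sums[rule_format])
  then show ?thesis by blast
qed

section \<open>The case of order nine\<close>

text \<open>Read in base three, row \<open>i = 3a + b\<close> and column \<open>j = 3c + d\<close> are joined by four linear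
  forms over the field with three elements, no two of which become proportional on any of the
  subspaces \<open>i = 0\<close>, \<open>j = 0\<close>, \<open>i = j\<close>, \<open>i = -j\<close>.\<close>

definition ternary_array :: "nat \<Rightarrow> nat \<Rightarrow> nat \<Rightarrow> nat" where
  "ternary_array i j k =
     [i mod 3 + j div 3,
      i div 3 + 2 * (j mod 3),
      i div 3 + i mod 3 + 2 * (j div 3) + j mod 3,
      i div 3 + 2 * (i mod 3) + j div 3 + j mod 3] ! k mod 3"

text \<open>Puts strength two into an executable form: distinctness of a list of pairs, for each
  pair of positions \<open>k < l\<close>.\<close>

lemma orth_array_strength_2I:
  assumes "\<And>x k. x < q\<^sup>2 \<Longrightarrow> k < N \<Longrightarrow> D x k < q"
    and "\<And>k l. l < N \<Longrightarrow> k < l \<Longrightarrow> distinct (map (\<lambda>x. (D x k, D x l)) [0..<q\<^sup>2])"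
  shows "orth_array q 2 N D"
  unfolding orth_array_def
proof (intro conjI allI impI)
  fix T assume T: "T \<subseteq> {..<N} \<and> card T = 2"
  then obtain k l where kl: "T = {k, l}" "k \<noteq> l" by (meson card_2_iff)
  have *: "inj_on (\<lambda>x. restrict (D x) {k, l}) {..<q\<^sup>2}" if "k < l" "l < N" for k l
    using assms(2)[OF that(2,1)]
    by (auto simp: distinct_map inj_on_def restrict_def fun_eq_iff atLeast0LessThan split: if_splits)
  show "inj_on (\<lambda>x. restrict (D x) T) {..<q\<^sup>2}"
    using *[of k l] *[of l k] kl T by (cases "k < l") (auto simp: insert_commute)
qed (use assms(1) in auto)

lemma exists_CMS_9: "\<exists>B. CMS (3 ^ 2) (3 ^ 2) 2 B"
proof (rule CMS_if_digit_array[where E = ternary_array])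
  have row: "\<forall>i\<in>set [0..<9]. \<forall>l\<in>set [0..<4]. \<forall>k\<in>set [0..<l].
      distinct (map (\<lambda>j. (ternary_array i j k, ternary_array i j l)) [0..<9])"
    by code_simp
  have col: "\<forall>j\<in>set [0..<9]. \<forall>l\<in>set [0..<4]. \<forall>k\<in>set [0..<l].
      distinct (map (\<lambda>i. (ternary_array i j k, ternary_array i j l)) [0..<9])"
    by code_simp
  have diag: "\<forall>l\<in>set [0..<4]. \<forall>k\<in>set [0..<l].
      distinct (map (\<lambda>i. (ternary_array i i k, ternary_array i i l)) [0..<9])"
    by code_simp
  \<comment> \<open>The map \<open>i \<mapsto> 8 - i\<close> replaces each ternary digit
    \<open>a\<close> by \<open>2 - a\<close>, so it is negation followed by a translation modulo
    three.\<close>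
  have anti: "\<forall>l\<in>set [0..<4]. \<forall>k\<in>set [0..<l].
      distinct (map (\<lambda>i. (ternary_array i (8 - i) k, ternary_array i (8 - i) l)) [0..<9])"
    by code_simp
  have all: "distinct (map (\<lambda>(i, j). map (ternary_array i j) [0..<4]) (List.product [0..<9] [0..<9]))"
    by code_simp
  show less: "ternary_array i j k < 3" for i j k by (simp add: ternary_array_def)
  show "inj_on (\<lambda>(i, j). restrict (ternary_array i j) {..<2 * 2}) ({..<3\<^sup>2} \<times> {..<3\<^sup>2})"
  proof (rule inj_onI, clarsimp)
    fix i j i' j' assume *: "i < 9" "j < 9" "i' < 9" "j' < (9::nat)"
      and eq: "restrict (ternary_array i j) {..<4} = restrict (ternary_array i' j') {..<4}"
    have "map (ternary_array i j) [0..<4] = map (ternary_array i' j') [0..<4]"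
    proof (rule map_cong[OF refl])
      fix k :: nat assume "k \<in> set [0..<4]"
      then show "ternary_array i j k = ternary_array i' j' k" using fun_cong[OF eq, of k] by simp
    qed
    then show "i = i' \<and> j = j'"
      using all * unfolding distinct_map by (auto dest: inj_onD[where x = "(i, j)" and y = "(i', j')"])
  qed
  show "orth_array 3 2 (2 * 2) (ternary_array i)" if "i < 3\<^sup>2" for i
    using row that less by (intro orth_array_strength_2I) auto
  show "orth_array 3 2 (2 * 2) (\<lambda>i. ternary_array i j)" if "j < 3\<^sup>2" for j
    using col that less by (intro orth_array_strength_2I) auto
  show "orth_array 3 2 (2 * 2) (\<lambda>i. ternary_array i i)"
    using diag less by (intro orth_array_strength_2I) auto
  show "orth_array 3 2 (2 * 2) (\<lambda>i. ternary_array i (3\<^sup>2 - 1 - i))"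
    using anti less by (intro orth_array_strength_2I) auto
qed simp

section \<open>Binomial theorem and Frobenius map in prime characteristic\<close>

context cring
begin

lemma add_pow_eq_zero_if_dvd:
  assumes "[p] \<cdot> \<one> = \<zero>" and "p dvd (m :: nat)" and "x \<in> carrier R"
  shows "[m] \<cdot> x = \<zero>"
proof -
  obtain r where m: "m = p * r" using assms(2) by blast
  have "[p] \<cdot> x = ([p] \<cdot> \<one>) \<otimes> x"
    using assms(3) add_pow_ldistr[of \<one> x p] by simp
  then have "[p] \<cdot> x = \<zero>" using assms by simp
  then show ?thesis
    using assms(3) add.nat_pow_pow[of x r p] by (simp add: m)
qed

lemma binomial_finsum:
  assumes a: "a \<in> carrier R" and b: "b \<in> carrier R"
  shows "(a \<oplus> b) [^] n = (\<Oplus>k\<in>{..n}. [(n choose k)] \<cdot> (a [^] k \<otimes> b [^] (n - k)))"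
proof (induction n)
  case 0
  then show ?case by simp
next
  case (Suc n)
  let ?g = "\<lambda>n k. [(n choose k)] \<cdot> (a [^] k \<otimes> b [^] (n - k))"
  have g: "?g m k \<in> carrier R" for m k using a b by simp
  \<comment> \<open>Pascal's rule, multiplied by the common monomial.\<close>
  have step: "?g (Suc n) (Suc k) = a \<otimes> ?g n k \<oplus> b \<otimes> ?g n (Suc k)" for k
  proof -
    have "a \<otimes> ?g n k = [(n choose k)] \<cdot> (a [^] Suc k \<otimes> b [^] (n - k))"
      using a b add_pow_rdistr[of a "a [^] k \<otimes> b [^] (n - k)" "n choose k"]
      by (simp add: m_ac)
    moreover have "b \<otimes> ?g n (Suc k) = [(n choose Suc k)] \<cdot> (a [^] Suc k \<otimes> b [^] (n - k))"
    \<comment> \<open>For \<open>k \<ge> n\<close> the exponent \<open>n - Suc k\<close> is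
      truncated to zero, but then \<open>n choose Suc k\<close> vanishes.\<close>
    proof (cases "k < n")
      case True
      then have "n - k = Suc (n - Suc k)" by simp
      then have "b \<otimes> (a [^] Suc k \<otimes> b [^] (n - Suc k)) = a [^] Suc k \<otimes> b [^] (n - k)"
        using a b by (simp add: m_ac)
      then show ?thesis
        using a b add_pow_rdistr[of b "a [^] Suc k \<otimes> b [^] (n - Suc k)" "n choose Suc k"] by simp
    next
      case False
      then show ?thesis using b by (simp add: binomial_eq_0)
    qed
    ultimately show ?thesis
      using a b add.nat_pow_mult[of "a [^] Suc k \<otimes> b [^] (n - k)" "n choose k" "n choose Suc k"]
      by simp
  qed
  have "(\<Oplus>k\<in>{..Suc n}. ?g (Suc n) k) = (\<Oplus>k\<in>{..n}. ?g (Suc n) (Suc k)) \<oplus> ?g (Suc n) 0"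
    by (rule finsum_Suc2) (use g in auto)
  also have "\<dots> = (\<Oplus>k\<in>{..n}. a \<otimes> ?g n k) \<oplus> (\<Oplus>k\<in>{..n}. b \<otimes> ?g n (Suc k)) \<oplus> b \<otimes> ?g n 0"
    unfolding step using a b g by (simp add: finsum_addf m_ac)
  also have "\<dots> = (\<Oplus>k\<in>{..n}. a \<otimes> ?g n k) \<oplus> (\<Oplus>k\<in>{..Suc n}. b \<otimes> ?g n k)"
  proof -
    have "(\<Oplus>k\<in>{..Suc n}. b \<otimes> ?g n k) = (\<Oplus>k\<in>{..n}. b \<otimes> ?g n (Suc k)) \<oplus> b \<otimes> ?g n 0"
      by (rule finsum_Suc2) (use b g in auto)
    moreover have "(\<Oplus>k\<in>{..n}. a \<otimes> ?g n k) \<in> carrier R" "(\<Oplus>k\<in>{..n}. b \<otimes> ?g n (Suc k)) \<in> carrier R"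
      "b \<otimes> ?g n 0 \<in> carrier R"
      using a b by (auto intro!: finsum_closed)
    ultimately show ?thesis by (simp only: a_assoc)
  qed
  also have "(\<Oplus>k\<in>{..Suc n}. b \<otimes> ?g n k) = (\<Oplus>k\<in>{..n}. b \<otimes> ?g n k)"
    using a b by (subst finsum_Suc) (auto simp: binomial_eq_0)
  also have "(\<Oplus>k\<in>{..n}. a \<otimes> ?g n k) = a \<otimes> (\<Oplus>k\<in>{..n}. ?g n k)"
    using a g by (intro finsum_rdistr[symmetric]) auto
  also have "(\<Oplus>k\<in>{..n}. b \<otimes> ?g n k) = b \<otimes> (\<Oplus>k\<in>{..n}. ?g n k)"
    using b g by (intro finsum_rdistr[symmetric]) auto
  also have "a \<otimes> (\<Oplus>k\<in>{..n}. ?g n k) \<oplus> b \<otimes> (\<Oplus>k\<in>{..n}. ?g n k) = (a \<oplus> b) [^] Suc n"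
    unfolding Suc[symmetric] using a b by (simp add: l_distr m_comm)
  finally show ?case by simp
qed

text \<open>For \<open>m = 1\<close> only the two outer terms of the binomial sum survive, because
  \<open>p\<close> divides the inner coefficients; the general case iterates this \<open>m\<close>
  times.\<close>

lemma frobenius_add:
  assumes p: "prime (p :: nat)" and char: "[p] \<cdot> \<one> = \<zero>"
    and a: "a \<in> carrier R" and b: "b \<in> carrier R"
  shows "(a \<oplus> b) [^] (p ^ m) = a [^] (p ^ m) \<oplus> b [^] (p ^ m)"
proof -
  have prime_case: "(a \<oplus> b) [^] p = a [^] p \<oplus> b [^] p" if a: "a \<in> carrier R" and b: "b \<in> carrier R" for a b
  proof -
    let ?g = "\<lambda>k. [(p choose k)] \<cdot> (a [^] k \<otimes> b [^] (p - k))"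
    have "(\<Oplus>k\<in>{..p}. ?g k) = (\<Oplus>k\<in>{0, p}. ?g k)"
    proof (rule add.finprod_mono_neutral_cong_right)
      show "?g k = \<zero>" if "k \<in> {..p} - {0, p}" for k
        using that p a b by (auto intro!: add_pow_eq_zero_if_dvd[OF char] dvd_choose_prime)
    qed (use a b in auto)
    also have "\<dots> = b [^] p \<oplus> a [^] p"
      using a b prime_gt_0_nat[OF p] by simp
    finally show ?thesis using binomial_finsum[OF a b, of p] a b by (simp add: a_comm)
  qed
  show ?thesis
  proof (induction m)
    case 0
    then show ?case using a b by simp
  next
    case (Suc m)
    have pow: "x [^] (p ^ Suc m) = (x [^] (p ^ m)) [^] p" if "x \<in> carrier R" for x
      using that by (simp add: nat_pow_pow mult.commute)
    show ?case using a b prime_case by (simp add: pow Suc del: power_Suc)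
  qed
qed

lemma frobenius_minus:
  assumes p: "prime (p :: nat)" and char: "[p] \<cdot> \<one> = \<zero>" and a: "a \<in> carrier R"
  shows "(\<ominus> a) [^] (p ^ m) = \<ominus> (a [^] (p ^ m))"
proof -
  have "\<zero> [^] (p ^ m) = \<zero>"
    using prime_gt_0_nat[OF p] by (simp add: nat_pow_zero)
  then have "(\<ominus> a) [^] (p ^ m) \<oplus> a [^] (p ^ m) = \<zero>"
    using frobenius_add[OF p char, of "\<ominus> a" a m] a by (simp add: l_neg)
  then show ?thesis using a by (simp add: minus_equality)
qed

end

section \<open>Finite fields as fixed fields of Frobenius powers\<close>

lemma (in field) subfield_frobenius_fixed:
  assumes p: "prime (p :: nat)" and char: "[p] \<cdot> \<one> = \<zero>"
  shows "subfield {x \<in> carrier R. x [^] (p ^ m) = x} R"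
proof (rule subfieldI')
  show "subring {x \<in> carrier R. x [^] (p ^ m) = x} R"
    by (rule subringI)
      (auto simp: frobenius_add[OF p char] frobenius_minus[OF p char] nat_pow_distrib)
next
  fix k assume "k \<in> {x \<in> carrier R. x [^] (p ^ m) = x} - {\<zero>}"
  then have k: "k \<in> carrier R" "k [^] (p ^ m) = k" "k \<in> Units R" "k \<noteq> \<zero>" by (auto simp: field_Units)
  have "k [^] (p ^ m) \<otimes> inv k [^] (p ^ m) = (k \<otimes> inv k) [^] (p ^ m)"
    using k by (intro nat_pow_distrib[symmetric]) auto
  then have "k \<otimes> inv k [^] (p ^ m) = \<one>" using k by simp
  then have "inv k [^] (p ^ m) = inv k"
    using k comm_inv_char[of k "inv k [^] (p ^ m)"] by simp
  then show "inv k \<in> {x \<in> carrier R. x [^] (p ^ m) = x}" using k by simp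
qed

lemma (in ring_hom_ring) hom_add_pow_nat:
  assumes "x \<in> carrier R"
  shows "h ([(n :: nat)] \<cdot>\<^bsub>R\<^esub> x) = [n] \<cdot>\<^bsub>S\<^esub> h x"
  using assms by (induction n) (simp_all add: R.add.nat_pow_Suc S.add.nat_pow_Suc)

text \<open>\<open>X ^ q - X\<close> is separable: at a root \<open>a\<close> it equals \<open>(X - a) ^ q - (X - a)\<close>.\<close>

lemma (in algebraically_closed) card_frobenius_fixed:
  assumes p: "prime (p :: nat)" and char: "[p] \<cdot> \<one> = \<zero>" and "m \<ge> 1"
  shows "card {x \<in> carrier L. x [^] (p ^ m) = x} = p ^ m"
proof -
  let ?q = "p ^ m"
  let ?U = "poly_ring L"
  interpret UP: domain ?U
    by (rule univ_poly_is_domain[OF carrier_is_subring])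
  interpret C: ring_hom_ring L ?U poly_of_const
    using canonical_embedding_ring_hom[OF carrier_is_subring] by simp
  have "p \<le> ?q" using self_le_power[of p m] prime_gt_0_nat[OF p] assms(3) by simp
  then have q: "?q > 1" using prime_gt_1_nat[OF p] by linarith
  have charU: "[p] \<cdot>\<^bsub>?U\<^esub> \<one>\<^bsub>?U\<^esub> = \<zero>\<^bsub>?U\<^esub>"
    using C.hom_add_pow_nat[of \<one> p] char by simp
  have X: "X \<in> carrier ?U" by (rule var_closed(1)[OF carrier_is_subring])
  define P where "P = X [^]\<^bsub>?U\<^esub> ?q \<ominus>\<^bsub>?U\<^esub> X"
  have P: "P \<in> carrier ?U" using X by (simp add: P_def)
  have degX: "degree (X [^]\<^bsub>?U\<^esub> ?q) = ?q"
    using polynomial_pow_degree[OF X, of ?q] by (simp add: var_def)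
  have degmX: "degree (\<ominus>\<^bsub>?U\<^esub> X) = 1"
    using univ_poly_a_inv_degree[OF carrier_is_subring X] by (simp add: var_def)
  have degP: "degree P = ?q"
  proof -
    have "degree (poly_add (X [^]\<^bsub>?U\<^esub> ?q) (\<ominus>\<^bsub>?U\<^esub> X)) =
        max (degree (X [^]\<^bsub>?U\<^esub> ?q)) (degree (\<ominus>\<^bsub>?U\<^esub> X))"
    proof (rule poly_add_degree_eq[OF carrier_is_subring])
      show "degree (X [^]\<^bsub>?U\<^esub> ?q) \<noteq> degree (\<ominus>\<^bsub>?U\<^esub> X)"
        unfolding degX degmX using q by linarith
    qed (use X in \<open>auto simp: univ_poly_carrier\<close>)
    then have "degree (poly_add (X [^]\<^bsub>?U\<^esub> ?q) (\<ominus>\<^bsub>?U\<^esub> X)) = ?q"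
      unfolding degX degmX using q by linarith
    then show ?thesis by (simp add: P_def a_minus_def univ_poly_add del: poly_add.simps)
  qed
  have nz: "P \<noteq> []" using degP q prime_gt_0_nat[OF p] by auto
  have evalP: "eval P a = a [^] ?q \<ominus> a" if "a \<in> carrier L" for a
  proof -
    interpret ev: ring_hom_ring ?U L "\<lambda>r. eval r a"
      by (rule eval_ring_hom[OF carrier_is_subring that])
    show ?thesis using X that unfolding P_def a_minus_def
      by (simp add: ev.hom_nat_pow eval_var)
  qed
  have simple: "alg_mult P a \<le> 1" if a: "a \<in> carrier L" "a [^] ?q = a" for a
  proof (rule ccontr)
    assume "\<not> alg_mult P a \<le> 1"
    define Y where "Y = [\<one>, \<ominus> a]"
    have Y: "Y \<in> carrier ?U"
      using a unfolding Y_def sym[OF univ_poly_carrier] polynomial_def by auto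
    have "Y [^]\<^bsub>?U\<^esub> (2::nat) pdivides P"
      using le_alg_mult_imp_pdivides[OF a(1) P, of 2] \<open>\<not> alg_mult P a \<le> 1\<close> by (simp add: Y_def)
    then have dP: "Y [^]\<^bsub>?U\<^esub> (2::nat) divides\<^bsub>?U\<^esub> P" by (simp add: pdivides_def)
    let ?c = "poly_of_const a"
    have c: "?c \<in> carrier ?U" using a(1) by simp
    have Yeq: "Y = X \<ominus>\<^bsub>?U\<^esub> ?c"
    proof -
      have "X \<ominus>\<^bsub>?U\<^esub> ?c = poly_add [\<one>, \<zero>] (poly_of_const (\<ominus> a))"
        using a(1) by (simp add: a_minus_def univ_poly_add var_def del: poly_add.simps)
      also have "\<dots> = Y" using a(1) by (simp add: poly_of_const_def Y_def)
      finally show ?thesis by simp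
    qed
    \<comment> \<open>The Frobenius identity is applied in the polynomial ring, which also has
      characteristic \<open>p\<close>; the constant \<open>a\<close> is its own \<open>q\<close>-th
      power.\<close>
    have "Y [^]\<^bsub>?U\<^esub> ?q = X [^]\<^bsub>?U\<^esub> ?q \<ominus>\<^bsub>?U\<^esub> ?c [^]\<^bsub>?U\<^esub> ?q"
      unfolding Yeq a_minus_def
      using UP.frobenius_add[OF p charU X, of "\<ominus>\<^bsub>?U\<^esub> ?c" m] UP.frobenius_minus[OF p charU c, of m] c
      by simp
    also have "?c [^]\<^bsub>?U\<^esub> ?q = ?c"
      using C.hom_nat_pow[of a ?q] a by simp
    finally have Yq: "Y [^]\<^bsub>?U\<^esub> ?q = X [^]\<^bsub>?U\<^esub> ?q \<ominus>\<^bsub>?U\<^esub> ?c" .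
    have Yeq2: "Y = Y [^]\<^bsub>?U\<^esub> ?q \<ominus>\<^bsub>?U\<^esub> P"
    proof -
      have "Y [^]\<^bsub>?U\<^esub> ?q \<ominus>\<^bsub>?U\<^esub> P = X \<ominus>\<^bsub>?U\<^esub> ?c"
        unfolding Yq P_def a_minus_def using X c UP.nat_pow_closed[OF X, of ?q]
        by (simp add: UP.minus_add UP.a_ac UP.r_neg)
      then show ?thesis using Yeq by simp
    qed
    obtain r where r: "r \<in> carrier ?U" "P = Y [^]\<^bsub>?U\<^esub> (2::nat) \<otimes>\<^bsub>?U\<^esub> r"
      using dP unfolding factor_def by blast
    have Ypow: "Y [^]\<^bsub>?U\<^esub> ?q = Y [^]\<^bsub>?U\<^esub> (2::nat) \<otimes>\<^bsub>?U\<^esub> Y [^]\<^bsub>?U\<^esub> (?q - 2)"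
    proof -
      have "2 + (?q - 2) = ?q" using q by linarith
      then show ?thesis using UP.nat_pow_mult[OF Y, of 2 "?q - 2"] by (simp only:)
    qed
    \<comment> \<open>A multiple root makes \<open>P\<close> divisible by \<open>Y ^ 2\<close>, and
      \<open>Y ^ q\<close> is so because \<open>q \<ge> 2\<close>. Hence \<open>Y ^ 2\<close>
      divides their difference \<open>Y\<close>, which the degrees forbid.\<close>
    have "Y = Y [^]\<^bsub>?U\<^esub> (2::nat) \<otimes>\<^bsub>?U\<^esub> (Y [^]\<^bsub>?U\<^esub> (?q - 2) \<ominus>\<^bsub>?U\<^esub> r)"
      using Yeq2 unfolding Ypow r(2) a_minus_def using Y r(1)
      by (simp add: UP.r_distr UP.r_minus)
    then have "Y [^]\<^bsub>?U\<^esub> (2::nat) pdivides Y"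
      unfolding pdivides_def factor_def using Y r(1) by (metis UP.minus_closed UP.nat_pow_closed)
    then have "degree (Y [^]\<^bsub>?U\<^esub> (2::nat)) \<le> degree Y"
      using Y by (intro pdivides_imp_degree_le[OF carrier_is_subring]) (auto simp: Y_def)
    then show False using polynomial_pow_degree[OF Y, of 2] by (simp add: Y_def)
  qed
  have mem: "a \<in># roots P \<longleftrightarrow> a \<in> {x \<in> carrier L. x [^] ?q = x}" for a
    using roots_mem_iff_is_root[OF P, of a] nz evalP by (auto simp: is_root_def)
  \<comment> \<open>All multiplicities are one, so counting roots with multiplicity, which gives the
    degree since \<open>P\<close> splits, also counts the fixed points.\<close>
  have "roots P = mset_set (set_mset (roots P))"
  proof (rule multiset_eqI)
    fix a
    show "count (roots P) a = count (mset_set (set_mset (roots P))) a"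
    proof (cases "a \<in># roots P")
      case True
      then have "count (roots P) a \<le> 1"
        using simple[of a] mem[of a] by (simp add: alg_mult_eq_count_roots[OF P])
      moreover have "count (roots P) a \<noteq> 0" using True by (simp add: not_in_iff)
      ultimately have "count (roots P) a = 1" by linarith
      then show ?thesis using True by simp
    next
      case False
      then show ?thesis by (simp add: not_in_iff)
    qed
  qed
  then have "size (roots P) = card (set_mset (roots P))"
    by (metis size_mset_set)
  moreover have "size (roots P) = ?q"
    using roots_over_carrier[OF P] degP by (simp add: splitted_def)
  moreover have "set_mset (roots P) = {x \<in> carrier L. x [^] ?q = x}" using mem by blast
  ultimately show ?thesis by simp
qed

text \<open>The field consists of the solutions of \<open>x ^ (p ^ m) = x\<close> in an algebraic
  closure of the integers modulo \<open>p\<close>. The element type is the one that the closure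
  construction yields over \<open>int\<close>.\<close>

lemma exists_finite_field:
  assumes p: "prime (p :: nat)" and m: "m \<ge> 1"
  shows "\<exists>F :: ((int list \<times> nat) multiset \<Rightarrow> int) ring.
           field F \<and> card (carrier F) = p ^ m \<and> [p] \<cdot>\<^bsub>F\<^esub> \<one>\<^bsub>F\<^esub> = \<zero>\<^bsub>F\<^esub>"
proof -
  interpret Z: residues_prime p "residue_ring (int p)"
    by unfold_locales (use p in auto)
  interpret Z: field "residue_ring (int p)" by (rule Z.is_field)
  obtain L :: "((int list \<times> nat) multiset \<Rightarrow> int) ring" and K
    where L: "algebraic_closure L K" and h: "Z.indexed_const \<in> ring_hom (residue_ring (int p)) L"
    using Z.exists_closure by metis
  interpret L: algebraic_closure L K by (rule L)
  interpret h: ring_hom_ring "residue_ring (int p)" L Z.indexed_const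
    using h by (intro ring_hom_ringI2) unfold_locales
  have "[n] \<cdot>\<^bsub>residue_ring (int p)\<^esub> \<one>\<^bsub>residue_ring (int p)\<^esub> = int n mod int p" for n :: nat
    by (induction n)
      (simp_all add: Z.add.nat_pow_Suc Z.res_zero_eq Z.res_one_eq Z.res_add_eq mod_simps add.commute)
  from this[of p] have "[p] \<cdot>\<^bsub>residue_ring (int p)\<^esub> \<one>\<^bsub>residue_ring (int p)\<^esub> = \<zero>\<^bsub>residue_ring (int p)\<^esub>"
    by (simp add: Z.res_zero_eq)
  then have char: "[p] \<cdot>\<^bsub>L\<^esub> \<one>\<^bsub>L\<^esub> = \<zero>\<^bsub>L\<^esub>"
    using h.hom_add_pow_nat[of "\<one>\<^bsub>residue_ring (int p)\<^esub>" p] by simp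
  define F where "F = L\<lparr>carrier := {x \<in> carrier L. x [^]\<^bsub>L\<^esub> (p ^ m) = x}\<rparr>"
  have "field F"
    unfolding F_def by (rule L.subfield_iff(2)[OF L.subfield_frobenius_fixed[OF p char]])
  moreover have "card (carrier F) = p ^ m"
    using L.card_frobenius_fixed[OF p char m] by (simp add: F_def)
  moreover have "[p] \<cdot>\<^bsub>F\<^esub> \<one>\<^bsub>F\<^esub> = \<zero>\<^bsub>F\<^esub>"
    using char by (simp add: F_def add_pow_def nat_pow_def)
  ultimately show ?thesis by blast
qed

section \<open>Enumerations compatible with an involution\<close>

text \<open>Each two-element orbit \<open>{x, f x}\<close> occupies two opposite places, from the
  outside inwards. What remains at the end is empty or a single fixed point, which goes into the
  middle.\<close>

lemma exists_symmetric_enumeration: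
  assumes "finite A" and "\<And>x. x \<in> A \<Longrightarrow> f x \<in> A" and "\<And>x. x \<in> A \<Longrightarrow> f (f x) = x"
    and "\<And>x y. x \<in> A \<Longrightarrow> y \<in> A \<Longrightarrow> f x = x \<Longrightarrow> f y = y \<Longrightarrow> x = y"
  shows "\<exists>\<rho>. bij_betw \<rho> {..<card A} A \<and> (\<forall>i<card A. \<rho> (card A - 1 - i) = f (\<rho> i))"
  using assms
proof (induction A rule: finite_psubset_induct)
  case (psubset A)
  show ?case
  proof (cases "\<exists>x\<in>A. f x \<noteq> x")
    case False
    show ?thesis
    proof (cases "A = {}")
      case True
      then show ?thesis by (simp add: bij_betw_def)
    next
      case ne: False
      then obtain a where a: "a \<in> A" by blast
      have A: "A = {a}" using False psubset.prems(3) a by blast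
      show ?thesis using False A by (intro exI[of _ "\<lambda>_. a"]) (auto simp: bij_betw_def inj_on_def)
    qed
  next
    case True
    then obtain x where x: "x \<in> A" "f x \<noteq> x" by blast
    have fx: "f x \<in> A" "f (f x) = x" using psubset.prems x by auto
    define A' where "A' = A - {x, f x}"
    define N where "N = card A'"
    have cardA: "card A = N + 2"
    proof -
      have "A = insert x (insert (f x) A')" using x fx by (auto simp: A'_def)
      moreover have "x \<notin> insert (f x) A'" "f x \<notin> A'" "finite A'"
        using x psubset.hyps by (auto simp: A'_def)
      ultimately show ?thesis by (simp add: N_def)
    qed
    have "\<exists>\<rho>. bij_betw \<rho> {..<card A'} A' \<and> (\<forall>i<card A'. \<rho> (card A' - 1 - i) = f (\<rho> i))"
    proof (rule psubset.IH)
      show "A' \<subset> A" using x by (auto simp: A'_def)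
      show "f y \<in> A'" if "y \<in> A'" for y
        using that psubset.prems(1)[of y] psubset.prems(2)[of y] fx by (auto simp: A'_def)
      show "f (f y) = y" if "y \<in> A'" for y using that psubset.prems(2) by (simp add: A'_def)
      show "y = z" if "y \<in> A'" "z \<in> A'" "f y = y" "f z = z" for y z
        using that psubset.prems(3) by (simp add: A'_def)
    qed
    then obtain \<rho>' where bij: "bij_betw \<rho>' {..<N} A'"
      and sym: "\<And>i. i < N \<Longrightarrow> \<rho>' (N - 1 - i) = f (\<rho>' i)"
      by (auto simp: N_def)
    define \<rho> where "\<rho> i = (if i = 0 then x else if i = Suc N then f x else \<rho>' (i - 1))" for i
    have "\<rho> ` {..<N + 2} = A"
    proof -
      have "{..<N + 2} = insert 0 (insert (Suc N) (Suc ` {..<N}))"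
        by (simp only: add_2_eq_Suc' lessThan_Suc_eq_insert_0[of "Suc N"] lessThan_Suc[of N] image_insert)
      moreover have "\<rho> ` (Suc ` {..<N}) = A'"
      proof -
        have "\<rho> ` (Suc ` {..<N}) = \<rho>' ` {..<N}"
          unfolding image_image by (rule image_cong) (auto simp: \<rho>_def)
        then show ?thesis using bij by (simp add: bij_betw_def)
      qed
      moreover have "\<rho> 0 = x" "\<rho> (Suc N) = f x" by (simp_all add: \<rho>_def)
      ultimately have "\<rho> ` {..<N + 2} = insert x (insert (f x) A')"
        by (simp only: image_insert)
      then show ?thesis using x fx by (auto simp: A'_def)
    qed
    then have "bij_betw \<rho> {..<N + 2} A"
      using cardA by (simp add: bij_betw_def eq_card_imp_inj_on)
    moreover have "\<rho> (N + 2 - 1 - i) = f (\<rho> i)" if i: "i < N + 2" for i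
    proof -
      consider "i = 0" | "i = Suc N" | j where "i = Suc j" "j < N"
        using i by (cases i) (auto simp: less_Suc_eq)
      then show ?thesis
      proof cases
        case (3 j)
        then have "N - j = Suc (N - 1 - j)" "N - 1 - j \<noteq> N" by simp_all
        then show ?thesis using 3 sym[of j] by (simp add: \<rho>_def)
      qed (use fx in \<open>simp_all add: \<rho>_def\<close>)
    qed
    ultimately show ?thesis using cardA by (intro exI[of _ \<rho>]) simp
  qed
qed

section \<open>Words and the extended Reed--Solomon code\<close>

context ring
begin

text \<open>The length is fixed and leading zeros are kept, unlike in the normalized lists that
  represent polynomials. This models the space of polynomials of degree below \<open>t\<close> and
  makes the count of words a plain power.\<close>

definition words :: "nat \<Rightarrow> 'a list set" where
  "words t = {w. set w \<subseteq> carrier R \<and> length w = t}"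

text \<open>The single operation \<open>v - c * w\<close> covers the reversal
  \<open>w \<mapsto> e - w\<close>, differences of words, and the comparison of a word with a
  multiple of another.\<close>

definition sub_smult :: "'a \<Rightarrow> 'a list \<Rightarrow> 'a list \<Rightarrow> 'a list" where
  "sub_smult c v w = map2 (\<lambda>a b. a \<ominus> c \<otimes> b) v w"

lemma words_nth_closed: "w \<in> words t \<Longrightarrow> l < t \<Longrightarrow> w ! l \<in> carrier R"
  by (auto simp: words_def subset_iff)

lemma sub_smult_nth:
  "v \<in> words t \<Longrightarrow> w \<in> words t \<Longrightarrow> l < t \<Longrightarrow> sub_smult c v w ! l = v ! l \<ominus> c \<otimes> w ! l"
  by (simp add: sub_smult_def words_def)

lemma sub_smult_closed:
  assumes "c \<in> carrier R" "v \<in> words t" "w \<in> words t"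
  shows "sub_smult c v w \<in> words t"
proof -
  have "sub_smult c v w ! l \<in> carrier R" if "l < t" for l
    using assms that by (simp add: sub_smult_nth words_nth_closed)
  moreover have "length (sub_smult c v w) = t" using assms by (simp add: sub_smult_def words_def)
  ultimately show ?thesis by (auto simp: words_def in_set_conv_nth)
qed

lemma replicate_in_words: "a \<in> carrier R \<Longrightarrow> replicate t a \<in> words t"
  by (auto simp: words_def)

lemma words_eqI:
  "v \<in> words t \<Longrightarrow> w \<in> words t \<Longrightarrow> (\<And>l. l < t \<Longrightarrow> v ! l = w ! l) \<Longrightarrow> v = w"
  by (simp add: words_def list_eq_iff_nth_eq)

text \<open>Extended Reed--Solomon code: a word is the coefficient list of a polynomial, the first
  \<open>N\<close> symbols are its values at given points, and the last one is its leading coefficient,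
  the value at infinity.\<close>

definition rs_symbol :: "nat \<Rightarrow> (nat \<Rightarrow> 'a) \<Rightarrow> nat \<Rightarrow> 'a list \<Rightarrow> 'a" where
  "rs_symbol N pts k w = (if k < N then eval w (pts k) else hd w)"

lemma normalize_eq_Nil_imp_replicate: "normalize w = [] \<Longrightarrow> w = replicate (length w) \<zero>"
  by (induction w) (auto split: if_splits)

end

context field
begin

lemma eval_sub_smult:
  assumes "c \<in> carrier R" and "x \<in> carrier R" and "v \<in> words t" and "w \<in> words t"
  shows "eval (sub_smult c v w) x = eval v x \<ominus> c \<otimes> eval w x"
proof -
  have "length v = length w" "set v \<subseteq> carrier R" "set w \<subseteq> carrier R"
    using assms by (auto simp: words_def)
  then show ?thesis
  proof (induction v w rule: list_induct2)
    case Nil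
    then show ?case using assms by (simp add: sub_smult_def a_minus_def)
  next
    case (Cons a v b w)
    have cl: "a \<in> carrier R" "b \<in> carrier R" "eval v x \<in> carrier R" "eval w x \<in> carrier R"
      "x [^] length v \<in> carrier R"
      using Cons assms eval_in_carrier by auto
    have "eval (sub_smult c (a # v) (b # w)) x =
        (a \<ominus> c \<otimes> b) \<otimes> x [^] length v \<oplus> (eval v x \<ominus> c \<otimes> eval w x)"
      using Cons by (simp add: sub_smult_def)
    also have "\<dots> = (a \<otimes> x [^] length v \<oplus> eval v x) \<ominus> c \<otimes> (b \<otimes> x [^] length v \<oplus> eval w x)"
      using cl assms(1) by algebra
    finally show ?case using Cons by simp
  qed
qed

lemma rs_symbol_closed:
  assumes "w \<in> words t" and "t > 0" and "\<And>k. k < N \<Longrightarrow> pts k \<in> carrier R"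
  shows "rs_symbol N pts k w \<in> carrier R"
  using assms hd_in_set[of w] by (auto simp: rs_symbol_def words_def intro!: eval_in_carrier)

lemma rs_symbol_sub_smult:
  assumes "c \<in> carrier R" and "v \<in> words t" and "w \<in> words t" and "t > 0"
    and "\<And>k. k < N \<Longrightarrow> pts k \<in> carrier R"
  shows "rs_symbol N pts k (sub_smult c v w) = rs_symbol N pts k v \<ominus> c \<otimes> rs_symbol N pts k w"
proof (cases "k < N")
  case True
  then show ?thesis using assms by (simp add: rs_symbol_def eval_sub_smult)
next
  case False
  have "sub_smult c v w \<in> words t" using assms sub_smult_closed by blast
  then have "hd (sub_smult c v w) = sub_smult c v w ! 0" "hd v = v ! 0" "hd w = w ! 0"
    using assms by (auto simp: words_def intro!: hd_conv_nth)
  then show ?thesis using False assms by (simp add: rs_symbol_def sub_smult_nth[of v t w 0])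
qed

text \<open>A nonzero polynomial of degree below \<open>t\<close> has fewer than \<open>t\<close>
  roots. If one of the \<open>t\<close> zeros lies at infinity, the leading coefficient vanishes, so
  the degree is below \<open>t - 1\<close> while \<open>t - 1\<close> finite roots remain.\<close>

lemma rs_zero_if_many_zeros:
  assumes w: "w \<in> words t" and "t > 0"
    and pts: "\<And>k. k < N \<Longrightarrow> pts k \<in> carrier R" and inj: "inj_on pts {..<N}"
    and T: "T \<subseteq> {..<Suc N}" "card T = t" and zero: "\<And>k. k \<in> T \<Longrightarrow> rs_symbol N pts k w = \<zero>"
  shows "w = replicate t \<zero>"
proof (rule ccontr)
  assume "w \<noteq> replicate t \<zero>"
  define r where "r = normalize w"
  have ne: "r \<noteq> []"
    using \<open>w \<noteq> replicate t \<zero>\<close> normalize_eq_Nil_imp_replicate[of w] w by (auto simp: r_def words_def)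
  have set: "set w \<subseteq> carrier R" and len: "length w = t" using w by (auto simp: words_def)
  have r: "r \<in> carrier (poly_ring R)"
    unfolding r_def univ_poly_carrier[symmetric] using normalize_gives_polynomial[OF set] .
  have finT: "finite T" using T finite_subset by blast
  \<comment> \<open>Position \<open>N\<close> is the symbol at infinity; the others are evaluation
    points.\<close>
  define T' where "T' = T - {N}"
  have T': "T' \<subseteq> {..<N}" using T by (auto simp: T'_def)
  have "pts ` T' \<subseteq> set_mset (roots r)"
  proof
    fix y assume "y \<in> pts ` T'"
    then obtain k where k: "k \<in> T'" "y = pts k" by blast
    then have "k < N" "k \<in> T" using T' by (auto simp: T'_def)
    then have "eval w y = \<zero>" "y \<in> carrier R" using zero[of k] k pts by (auto simp: rs_symbol_def)
    then show "y \<in> set_mset (roots r)"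
      using roots_mem_iff_is_root[OF r, of y] ne eval_normalize[OF set, of y]
      by (simp add: is_root_def r_def)
  qed
  then have "card (pts ` T') \<le> card (set_mset (roots r))" by (intro card_mono) auto
  also have "\<dots> \<le> size (roots r)"
    using size_mset_mono[OF mset_set_set_mset_msubset, of "roots r"] by simp
  also have "\<dots> \<le> degree r" using size_roots_le_degree[OF r] .
  finally have "card (pts ` T') < length r" using ne by (cases r) auto
  moreover have "card (pts ` T') = card T'"
    using inj T' by (meson card_image inj_on_subset)
  moreover have "length r \<le> card T'"
  proof (cases "N \<in> T")
    case True
    then have "hd w = \<zero>" using zero[of N] by (simp add: rs_symbol_def)
    then have "length r < t"
      using len \<open>t > 0\<close> normalize_length_le[of "tl w"] by (cases w) (auto simp: r_def)
    then show ?thesis using True T finT by (simp add: T'_def)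
  next
    case False
    then show ?thesis using T normalize_length_le[of w] len by (simp add: T'_def r_def)
  qed
  ultimately show False by linarith
qed

text \<open>By linearity the word \<open>v - c * w\<close> has \<open>t\<close> zero symbols, hence
  is zero.\<close>

lemma rs_words_eqI:
  assumes "v \<in> words t" and "w \<in> words t" and "t > 0"
    and "\<And>k. k < N \<Longrightarrow> pts k \<in> carrier R" and "inj_on pts {..<N}"
    and "T \<subseteq> {..<Suc N}" "card T = t" and "c \<in> carrier R"
    and "\<And>k. k \<in> T \<Longrightarrow> rs_symbol N pts k v = c \<otimes> rs_symbol N pts k w"
    and "l < t"
  shows "v ! l = c \<otimes> w ! l"
proof -
  have "sub_smult c v w = replicate t \<zero>"
  proof (rule rs_zero_if_many_zeros[OF sub_smult_closed])
    show "rs_symbol N pts k (sub_smult c v w) = \<zero>" if "k \<in> T" for k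
    proof -
      have "rs_symbol N pts k v \<in> carrier R"
        using assms(1,3,4) by (rule rs_symbol_closed)
      moreover have "rs_symbol N pts k (sub_smult c v w) = rs_symbol N pts k v \<ominus> c \<otimes> rs_symbol N pts k w"
        using assms(8,1,2,3,4) by (rule rs_symbol_sub_smult)
      ultimately show ?thesis using assms(9)[OF that] by (metis r_right_minus_eq)
    qed
  qed (use assms in auto)
  then have "v ! l \<ominus> c \<otimes> w ! l = \<zero>"
    using sub_smult_nth[OF assms(1,2,10), of c] assms(10) by simp
  then show ?thesis using assms words_nth_closed by simp
qed

end

text \<open>Any \<open>t\<close> symbols determine a word, and this survives the translations
  \<open>u k\<close>, the nonzero factors \<open>v k\<close> and the relabelling
  \<open>\<delta>\<close>. Rows, columns and both diagonals are all of this form.\<close>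

lemma (in field) orth_array_rs:
  assumes card: "card (carrier R) = q" and "t > 0"
    and pts: "\<And>k. k < 2 * t - 1 \<Longrightarrow> pts k \<in> carrier R" "inj_on pts {..<2 * t - 1}"
    and \<delta>: "bij_betw \<delta> (carrier R) {..<q}" and \<rho>: "bij_betw \<rho> {..<q ^ t} (words t)"
    and u: "\<And>k. k < 2 * t \<Longrightarrow> u k \<in> carrier R"
    and v: "\<And>k. k < 2 * t \<Longrightarrow> v k \<in> carrier R - {\<zero>}"
    and D: "\<And>x k. x < q ^ t \<Longrightarrow> k < 2 * t \<Longrightarrow>
      D x k = \<delta> (u k \<oplus> v k \<otimes> rs_symbol (2 * t - 1) pts k (\<rho> x))"
  shows "orth_array q t (2 * t) D"
  unfolding orth_array_def
proof (intro conjI allI impI)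
  let ?rs = "rs_symbol (2 * t - 1) pts"
  have word: "\<rho> x \<in> words t" if "x < q ^ t" for x using \<rho> that by (auto simp: bij_betw_def)
  have rs: "?rs k w \<in> carrier R" if "w \<in> words t" for k w
    using that \<open>t > 0\<close> pts(1) by (rule rs_symbol_closed)
  have cl: "u k \<oplus> v k \<otimes> ?rs k (\<rho> x) \<in> carrier R" if "x < q ^ t" "k < 2 * t" for x k
    using u[OF that(2)] v[OF that(2)] rs[OF word[OF that(1)]] by simp
  show "D x k < q" if "x < q ^ t" "k < 2 * t" for x k
    using cl[OF that] D[OF that] \<delta> by (auto simp: bij_betw_def)
  fix T assume T: "T \<subseteq> {..<2 * t} \<and> card T = t"
  show "inj_on (\<lambda>x. restrict (D x) T) {..<q ^ t}"
  proof (rule inj_onI)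
    fix x y assume xy: "x \<in> {..<q ^ t}" "y \<in> {..<q ^ t}" and eq: "restrict (D x) T = restrict (D y) T"
    have rs_eq: "?rs k (\<rho> x) = ?rs k (\<rho> y)" if "k \<in> T" for k
    proof -
      have k: "k < 2 * t" using T that by auto
      have "D x k = D y k" using fun_cong[OF eq, of k] that by simp
      then have "u k \<oplus> v k \<otimes> ?rs k (\<rho> x) = u k \<oplus> v k \<otimes> ?rs k (\<rho> y)"
        using \<delta> cl k xy D by (auto simp: bij_betw_def dest: inj_onD)
      then show ?thesis
        using u[OF k] v[OF k] rs word xy by (simp add: m_lcancel)
    qed
    have "\<rho> x = \<rho> y"
    proof (rule words_eqI[OF word word])
      show "x < q ^ t" "y < q ^ t" using xy by auto
      fix l assume l: "l < t"
      have "\<rho> x ! l = \<one> \<otimes> \<rho> y ! l"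
      proof (rule rs_words_eqI[OF word word \<open>t > 0\<close> pts, where T = T])
        show "?rs k (\<rho> x) = \<one> \<otimes> ?rs k (\<rho> y)" if "k \<in> T" for k
          using rs_eq[OF that] rs word xy by simp
      qed (use xy T l in auto)
      then show "\<rho> x ! l = \<rho> y ! l" using words_nth_closed[OF word l] xy by simp
    qed
    then show "x = y" using \<rho> xy by (auto simp: bij_betw_def dest: inj_onD)
  qed
qed

section \<open>Choice of the multipliers and of the index order\<close>

lemma (in field) one_plus_one_eq_zero_iff:
  assumes "prime (p :: nat)" and "[p] \<cdot> \<one> = \<zero>"
  shows "\<one> \<oplus> \<one> = \<zero> \<longleftrightarrow> p = 2"
proof -
  have two: "[(2::nat)] \<cdot> \<one> = \<one> \<oplus> \<one>" by (simp add: numeral_2_eq_2)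
  show ?thesis
  proof
    assume *: "\<one> \<oplus> \<one> = \<zero>"
    show "p = 2"
    proof (rule ccontr)
      assume "p \<noteq> 2"
      then have "odd p" using assms(1) primes_dvd_imp_eq two_is_prime_nat by blast
      then obtain r where r: "p = Suc (2 * r)" by (auto elim: oddE)
      have "[(2 * r)] \<cdot> \<one> = \<zero>" using add_pow_eq_zero_if_dvd[of 2 "2 * r" \<one>] * two by simp
      then have "[p] \<cdot> \<one> = \<one>" by (simp add: r add.nat_pow_Suc)
      then show False using assms(2) by simp
    qed
  qed (use assms(2) two in simp)
qed

text \<open>In characteristic two \<open>1 = -1\<close>, so at most two of at least four elements
  are excluded. Otherwise the order is odd, hence at least five, and at most three are
  excluded.\<close>

lemma (in field) exists_multipliers:
  assumes "prime (p :: nat)" and "[p] \<cdot> \<one> = \<zero>" and "card (carrier R) = p ^ m" and "p ^ m \<ge> 4"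
  obtains c d where "c \<in> carrier R - {\<zero>, \<one>, \<ominus> \<one>}" "d \<in> carrier R - {\<zero>, \<one>, \<ominus> \<one>}" "c \<noteq> d"
proof -
  have "card (carrier R - {\<zero>, \<one>, \<ominus> \<one>}) \<ge> 2"
  proof (cases "p = 2")
    case True
    then have "\<ominus> \<one> = \<one>" using one_plus_one_eq_zero_iff[OF assms(1,2)] by (simp add: minus_equality)
    then have "card {\<zero>, \<one>, \<ominus> \<one>} \<le> 2" by (simp add: card_insert_if)
    then show ?thesis using diff_card_le_card_Diff[of "{\<zero>, \<one>, \<ominus> \<one>}" "carrier R"] assms(3,4) by simp
  next
    case False
    then have "odd (p ^ m)" using assms(1) primes_dvd_imp_eq two_is_prime_nat by (metis even_power)
    then have "p ^ m \<noteq> 4" by (metis even_numeral)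
    moreover have "card {\<zero>, \<one>, \<ominus> \<one>} \<le> 3" by (simp add: card_insert_if)
    ultimately show ?thesis
      using diff_card_le_card_Diff[of "{\<zero>, \<one>, \<ominus> \<one>}" "carrier R"] assms(3,4) by simp
  qed
  then obtain S where "S \<subseteq> carrier R - {\<zero>, \<one>, \<ominus> \<one>}" "card S = 2"
    using obtain_subset_with_card_n by metis
  then show ?thesis using that by (auto simp: card_2_iff)
qed

text \<open>Reversing the index must act as the involution \<open>w \<mapsto> e - w\<close>. For
  this the involution may have at most one fixed point, that is, one solution of
  \<open>w + w = e\<close> in every coordinate.\<close>

lemma (in field) exists_words_enumeration:
  assumes "prime (p :: nat)" and "[p] \<cdot> \<one> = \<zero>" and "finite (carrier R)" and "t > 0"
  obtains e \<rho> where "e \<in> carrier R" "bij_betw \<rho> {..<card (carrier R) ^ t} (words t)"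
    "\<And>i. i < card (carrier R) ^ t \<Longrightarrow>
       \<rho> (card (carrier R) ^ t - 1 - i) = sub_smult \<one> (replicate t e) (\<rho> i)"
proof -
  \<comment> \<open>In characteristic two \<open>w + w = 0\<close>, so \<open>e = 1\<close> excludes
    fixed points; otherwise \<open>e = 0\<close> leaves only the zero word.\<close>
  define e where "e = (if p = 2 then \<one> else \<zero>)"
  have e: "e \<in> carrier R" by (simp add: e_def)
  note char2 = one_plus_one_eq_zero_iff[OF assms(1,2)]
  let ?f = "sub_smult \<one> (replicate t e)"
  have nth: "?f w ! l = e \<ominus> w ! l" if "w \<in> words t" "l < t" for w l
    using sub_smult_nth[OF replicate_in_words[OF e] that, of \<one>] words_nth_closed[OF that] that(2) by simp
  have closed: "?f w \<in> words t" if "w \<in> words t" for w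
    using that e by (intro sub_smult_closed replicate_in_words) auto
  have cardw: "card (words t) = card (carrier R) ^ t"
    unfolding words_def using card_lists_length_eq[OF assms(3)] .
  have "\<exists>\<rho>. bij_betw \<rho> {..<card (words t)} (words t) \<and>
          (\<forall>i<card (words t). \<rho> (card (words t) - 1 - i) = ?f (\<rho> i))"
  proof (rule exists_symmetric_enumeration)
    show "finite (words t)" unfolding words_def using finite_lists_length_eq[OF assms(3)] .
    show "?f w \<in> words t" if "w \<in> words t" for w by (rule closed[OF that])
    show "?f (?f w) = w" if w: "w \<in> words t" for w
    proof (rule words_eqI[OF closed[OF closed[OF w]] w])
      fix l assume l: "l < t"
      have "w ! l \<in> carrier R" using words_nth_closed[OF w l] .
      then show "?f (?f w) ! l = w ! l"
        unfolding nth[OF closed[OF w] l] nth[OF w l] using e by algebra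
    qed
    show "v = w" if vw: "v \<in> words t" "w \<in> words t" "?f v = v" "?f w = w" for v w
    proof -
      have fixed: "e = x ! l \<oplus> x ! l" if "x \<in> words t" "?f x = x" "l < t" for x l
      proof -
        have x: "x ! l \<in> carrier R" using words_nth_closed[OF that(1,3)] .
        have "e = (e \<ominus> x ! l) \<oplus> x ! l" using e x by algebra
        also have "e \<ominus> x ! l = x ! l" using nth[OF that(1,3)] that(2) by simp
        finally show ?thesis .
      qed
      have two: "x \<oplus> x = (\<one> \<oplus> \<one>) \<otimes> x" if "x \<in> carrier R" for x using that by algebra
      show ?thesis
      proof (cases "p = 2")
        case True
        have v0: "v ! 0 \<in> carrier R" using words_nth_closed[OF vw(1) assms(4)] .
        have "\<one> = (\<one> \<oplus> \<one>) \<otimes> v ! 0"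
          using fixed[OF vw(1,3) assms(4)] two[OF v0] True by (simp add: e_def)
        also have "\<one> \<oplus> \<one> = \<zero>" using char2 True by simp
        finally show ?thesis using v0 by simp
      next
        case False
        have zero: "x ! l = \<zero>" if "x \<in> words t" "?f x = x" "l < t" for x l
        proof -
          have x: "x ! l \<in> carrier R" using words_nth_closed[OF that(1,3)] .
          have "(\<one> \<oplus> \<one>) \<otimes> x ! l = \<zero>" using fixed[OF that] two[OF x] False by (simp add: e_def)
          then show ?thesis using char2 False x by (simp add: integral_iff)
        qed
        show ?thesis using zero vw by (intro words_eqI[OF vw(1,2)]) metis
      qed
    qed
  qed
  then show ?thesis using that e unfolding cardw by blast
qed

section \<open>The squares over a field with at least four elements\<close>

text \<open>The digit \<open>rs i + \<gamma> * rs j\<close> has the varying word scaled by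
  \<open>\<gamma>\<close> on rows, by \<open>1\<close> on columns, by \<open>1 + \<gamma>\<close> on
  the main diagonal and by \<open>1 - \<gamma>\<close> on the back diagonal. Excluding
  \<open>0\<close>, \<open>1\<close> and \<open>-1\<close> as values of \<open>\<gamma>\<close>
  makes all these factors nonzero.\<close>

lemma (in field) exists_CMS_field:
  assumes p: "prime (p :: nat)" "[p] \<cdot> \<one> = \<zero>" and card: "card (carrier R) = q" "q = p ^ m"
    and "q \<ge> 4" and "t > 0" and "q \<ge> 2 * t - 1"
  shows "\<exists>B. CMS (q ^ t) (q ^ t) t B"
proof -
  have fin: "finite (carrier R)" using card(1) assms(5) by (intro card_ge_0_finite) linarith
  obtain c d where c: "c \<in> carrier R - {\<zero>, \<one>, \<ominus> \<one>}" and d: "d \<in> carrier R - {\<zero>, \<one>, \<ominus> \<one>}" and "c \<noteq> d"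
    using exists_multipliers[OF p, of m] card assms(5) by metis
  obtain e \<rho> where e: "e \<in> carrier R" and \<rho>: "bij_betw \<rho> {..<q ^ t} (words t)"
    and sym: "\<And>i. i < q ^ t \<Longrightarrow> \<rho> (q ^ t - 1 - i) = sub_smult \<one> (replicate t e) (\<rho> i)"
    using exists_words_enumeration[OF p fin \<open>t > 0\<close>] unfolding card(1) by metis
  obtain \<delta> where \<delta>: "bij_betw \<delta> (carrier R) {..<q}"
    using ex_bij_betw_finite_nat[OF fin] card by (auto simp: atLeast0LessThan)
  \<comment> \<open>The bound \<open>q \<ge> 2 * t - 1\<close> provides enough distinct evaluation
    points; the point at infinity supplies the last of the \<open>2 * t\<close> positions.\<close>
  obtain pts where pts: "\<And>k. k < 2 * t - 1 \<Longrightarrow> pts k \<in> carrier R" "inj_on pts {..<2 * t - 1}"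
  proof -
    have bij: "bij_betw (inv_into (carrier R) \<delta>) {..<q} (carrier R)" using bij_betw_inv_into[OF \<delta>] .
    show ?thesis
    proof (rule that)
      show "inv_into (carrier R) \<delta> k \<in> carrier R" if "k < 2 * t - 1" for k
        using bij that assms(7) by (auto simp: bij_betw_def)
      show "inj_on (inv_into (carrier R) \<delta>) {..<2 * t - 1}"
        using bij assms(7) by (auto simp: bij_betw_def intro: inj_on_subset)
    qed
  qed
  define rs where "rs = rs_symbol (2 * t - 1) pts"
  define \<gamma> where "\<gamma> k = (if k < t then c else d)" for k :: nat
  define E where "E i j k = \<delta> (rs k (\<rho> i) \<oplus> \<gamma> k \<otimes> rs k (\<rho> j))" for i j k
  have \<gamma>: "\<gamma> k \<in> carrier R" "\<gamma> k \<noteq> \<zero>" "\<one> \<oplus> \<gamma> k \<noteq> \<zero>" "\<one> \<ominus> \<gamma> k \<noteq> \<zero>" for k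
  proof -
    have *: "\<gamma> k \<in> carrier R - {\<zero>, \<one>, \<ominus> \<one>}" using c d by (simp add: \<gamma>_def)
    then show "\<gamma> k \<in> carrier R" "\<gamma> k \<noteq> \<zero>" by auto
    show "\<one> \<oplus> \<gamma> k \<noteq> \<zero>" using * minus_equality[of "\<gamma> k" \<one>] a_comm[of \<one> "\<gamma> k"] by auto
    show "\<one> \<ominus> \<gamma> k \<noteq> \<zero>" using * by auto
  qed
  have word: "\<rho> x \<in> words t" if "x < q ^ t" for x using \<rho> that by (auto simp: bij_betw_def)
  have rs: "rs k w \<in> carrier R" if "w \<in> words t" for k w
    unfolding rs_def using that \<open>t > 0\<close> pts(1) by (rule rs_symbol_closed)
  have rs_sub: "rs k (sub_smult b v w) = rs k v \<ominus> b \<otimes> rs k w"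
    if "b \<in> carrier R" "v \<in> words t" "w \<in> words t" for b v w k
    unfolding rs_def using that \<open>t > 0\<close> pts(1) by (rule rs_symbol_sub_smult)
  note oa = orth_array_rs[OF card(1) \<open>t > 0\<close> pts \<delta> \<rho>, folded rs_def]
  show ?thesis
  proof (rule CMS_if_digit_array[of q t E])
    show "q > 0" using assms(5) by simp
    show row: "orth_array q t (2 * t) (\<lambda>j. E i j)" if "i < q ^ t" for i
      using \<gamma> rs word[OF that] by (intro oa[where u = "\<lambda>k. rs k (\<rho> i)" and v = \<gamma>]) (auto simp: E_def)
    show "E i j k < q" if "i < q ^ t" "j < q ^ t" "k < 2 * t" for i j k
      using row[OF that(1)] that by (simp add: orth_array_def)
    show "orth_array q t (2 * t) (\<lambda>i. E i j)" if "j < q ^ t" for j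
      using \<gamma> rs word that
      by (intro oa[where u = "\<lambda>k. \<gamma> k \<otimes> rs k (\<rho> j)" and v = "\<lambda>_. \<one>"]) (auto simp: E_def a_comm)
    show "orth_array q t (2 * t) (\<lambda>i. E i i)"
      using \<gamma> rs word
      by (intro oa[where u = "\<lambda>_. \<zero>" and v = "\<lambda>k. \<one> \<oplus> \<gamma> k"]) (auto simp: E_def l_distr)
    show "orth_array q t (2 * t) (\<lambda>i. E i (q ^ t - 1 - i))"
    \<comment> \<open>The reversed index carries the word \<open>e - \<rho> i\<close>: its constant
      part goes into the translation, and its sign turns the factor into
      \<open>1 - \<gamma> k\<close>.\<close>
    proof (rule oa[where u = "\<lambda>k. \<gamma> k \<otimes> rs k (replicate t e)" and v = "\<lambda>k. \<one> \<ominus> \<gamma> k"])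
      fix i k assume i: "i < q ^ t"
      have w: "replicate t e \<in> words t" using e by (rule replicate_in_words)
      have cl: "rs k (\<rho> i) \<in> carrier R" "rs k (replicate t e) \<in> carrier R"
        using rs w word[OF i] by auto
      have "rs k (\<rho> (q ^ t - 1 - i)) = rs k (replicate t e) \<ominus> rs k (\<rho> i)"
        unfolding sym[OF i] using rs_sub[OF _ w word[OF i], of \<one>] cl by simp
      moreover have "rs k (\<rho> i) \<oplus> \<gamma> k \<otimes> (rs k (replicate t e) \<ominus> rs k (\<rho> i)) =
          \<gamma> k \<otimes> rs k (replicate t e) \<oplus> (\<one> \<ominus> \<gamma> k) \<otimes> rs k (\<rho> i)"
        using cl \<gamma>(1)[of k] by algebra
      ultimately show "E i (q ^ t - 1 - i) k =
          \<delta> (\<gamma> k \<otimes> rs k (replicate t e) \<oplus> (\<one> \<ominus> \<gamma> k) \<otimes> rs k (\<rho> i))"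
        by (simp add: E_def)
    qed (use \<gamma> rs replicate_in_words[OF e] in auto)
    show "inj_on (\<lambda>(i, j). restrict (E i j) {..<2 * t}) ({..<q ^ t} \<times> {..<q ^ t})"
    proof (rule inj_onI, clarsimp)
      fix i j i' j' assume ij: "i < q ^ t" "j < q ^ t" "i' < q ^ t" "j' < q ^ t"
        and eq: "restrict (E i j) {..<2 * t} = restrict (E i' j') {..<2 * t}"
      note w = ij[THEN word]
      \<comment> \<open>The second difference is taken in the opposite order, so that equality of
        digits reads \<open>rs k a = \<gamma> k * rs k b\<close> without a sign.\<close>
      define a b where "a = sub_smult \<one> (\<rho> i) (\<rho> i')" and "b = sub_smult \<one> (\<rho> j') (\<rho> j)"
      have a: "a \<in> words t" and b: "b \<in> words t" using w by (auto simp: a_def b_def intro: sub_smult_closed)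
      have rs_ab: "rs k a = \<gamma> k \<otimes> rs k b" if "k < 2 * t" for k
      proof -
        have cl: "rs k (\<rho> i) \<in> carrier R" "rs k (\<rho> j) \<in> carrier R" "rs k (\<rho> i') \<in> carrier R" "rs k (\<rho> j') \<in> carrier R"
          using w rs by auto
        have "E i j k = E i' j' k" using fun_cong[OF eq, of k] that by simp
        then have *: "rs k (\<rho> i) \<oplus> \<gamma> k \<otimes> rs k (\<rho> j) = rs k (\<rho> i') \<oplus> \<gamma> k \<otimes> rs k (\<rho> j')"
          unfolding E_def using \<delta> cl \<gamma>(1) by (auto simp: bij_betw_def dest: inj_onD)
        have "rs k (\<rho> i) \<ominus> rs k (\<rho> i') =
            (rs k (\<rho> i) \<oplus> \<gamma> k \<otimes> rs k (\<rho> j)) \<ominus> rs k (\<rho> i') \<ominus> \<gamma> k \<otimes> rs k (\<rho> j)"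
          using cl \<gamma>(1)[of k] by algebra
        also have "\<dots> = \<gamma> k \<otimes> (rs k (\<rho> j') \<ominus> rs k (\<rho> j))"
          unfolding * using cl \<gamma>(1)[of k] by algebra
        finally show ?thesis using w cl by (simp add: a_def b_def rs_sub)
      qed
      \<comment> \<open>Each half of the positions has \<open>t\<close> symbols and so determines a
        word: the lower half gives \<open>a = c * b\<close>, the upper half, which includes
        infinity, gives \<open>a = d * b\<close>.\<close>
      have T: "{..<t} \<subseteq> {..<Suc (2 * t - 1)}" "{t..<2 * t} \<subseteq> {..<Suc (2 * t - 1)}" by auto
      have ab: "a ! l = c \<otimes> b ! l" "a ! l = d \<otimes> b ! l" if "l < t" for l
      proof -
        show "a ! l = c \<otimes> b ! l"
        proof (rule rs_words_eqI[OF a b \<open>t > 0\<close> pts T(1)])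
          show "rs_symbol (2 * t - 1) pts k a = c \<otimes> rs_symbol (2 * t - 1) pts k b" if "k \<in> {..<t}" for k
            using rs_ab[of k] that by (simp add: \<gamma>_def rs_def)
        qed (use c that in auto)
        show "a ! l = d \<otimes> b ! l"
        proof (rule rs_words_eqI[OF a b \<open>t > 0\<close> pts T(2)])
          show "rs_symbol (2 * t - 1) pts k a = d \<otimes> rs_symbol (2 * t - 1) pts k b" if "k \<in> {t..<2 * t}" for k
            using rs_ab[of k] that by (simp add: \<gamma>_def rs_def)
        qed (use d that in auto)
      qed
      \<comment> \<open>As \<open>c \<noteq> d\<close>, the relations \<open>a = c * b\<close> and
        \<open>a = d * b\<close> leave only \<open>b = 0\<close>.\<close>
      have b0: "b ! l = \<zero>" if "l < t" for l
      proof (rule ccontr)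
        assume "b ! l \<noteq> \<zero>"
        then show False
          using ab[OF that] words_nth_closed[OF b that] c d \<open>c \<noteq> d\<close> by (simp add: m_rcancel)
      qed
      have a0: "a ! l = \<zero>" if "l < t" for l using ab(1)[OF that] b0[OF that] c by simp
      have "\<rho> i = \<rho> i'"
      proof (rule words_eqI[OF w(1,3)])
        fix l assume l: "l < t"
        show "\<rho> i ! l = \<rho> i' ! l"
          using a0[OF l] sub_smult_nth[OF w(1,3) l, of \<one>] words_nth_closed[OF w(1) l]
            words_nth_closed[OF w(3) l] by (simp add: a_def)
      qed
      moreover have "\<rho> j' = \<rho> j"
      proof (rule words_eqI[OF w(4,2)])
        fix l assume l: "l < t"
        show "\<rho> j' ! l = \<rho> j ! l"
          using b0[OF l] sub_smult_nth[OF w(4,2) l, of \<one>] words_nth_closed[OF w(4) l]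
            words_nth_closed[OF w(2) l] by (simp add: b_def)
      qed
      ultimately show "i = i' \<and> j = j'" using \<rho> ij by (auto simp: bij_betw_def dest: inj_onD)
    qed
  qed
qed

theorem theorem3p1:
  fixes t q :: nat
  assumes "t \<ge> 2" and "prime_power q" and "q \<ge> 2 * t - 1"
  shows "\<exists>B. CMS (q ^ t) (q ^ t) t B"
proof (cases "q = 3")
  case True
  \<comment> \<open>The bounds give \<open>q \<ge> 2 * t - 1 \<ge> 3\<close>, so
    \<open>q = 3\<close> leaves only \<open>t = 2\<close>, and every other \<open>q\<close> is at
    least four.\<close>
  then have "t = 2" using assms(1,3) by simp
  then show ?thesis using True exists_CMS_9 by simp
next
  case False
  then have q: "q \<ge> 4" using assms(1,3) by simp
  obtain p m where pm: "prime p" "m \<ge> 1" "q = p ^ m"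
    using assms(2) unfolding prime_power_def by blast
  obtain F :: "((int list \<times> nat) multiset \<Rightarrow> int) ring" where F: "field F"
    and "card (carrier F) = p ^ m" and "[p] \<cdot>\<^bsub>F\<^esub> \<one>\<^bsub>F\<^esub> = \<zero>\<^bsub>F\<^esub>"
    using exists_finite_field[OF pm(1,2)] by blast
  then show ?thesis
    using field.exists_CMS_field[OF F pm(1), of q m t] pm(3) q assms(1,3) by simp
qed

end
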